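(* Let $\mathrm r=(r_1,\dots,r_d)\in\mathbb{Z}_+^d$ with $\mathrm r>0$. Then the map $\Phi:\mathcal F_d^{\mathrm r}\to S_d^{\mathrm r}\times C_d^{\mathrm r}$, $(\mathbf f,c_{\mathbf f})\mapsto(\Psi((\mathbf f,c_{\mathbf f})),\mathrm c_{(\mathbf f,c_{\mathbf f})})$, is a bijection.
   Context: $d\ge2$, $[d]=\{1,\dots,d\}$. A plane forest is a finite or infinite sequence $\mathbf t_1,\mathbf t_2,\dots$ of finite rooted plane (ordered) trees; its vertices are listed in breadth-first search order (first the vertices of $\mathbf t_1$ generation by generation, each generation from left to right, then those of $\mathbf t_2$, etc.). A $d$-type forest $(\mathbf f,c_{\mathbf f})$ is a plane forest with a map $c_{\mathbf f}$ from its vertices to $[d]$ (the type) such that children of a common parent appear, from left to right, in nondecreasing order of type; $\mathcal F_d$ is the set of (unlabeled) $d$-type forests. $p_j(u)$ is the number of children of type $j$ of vertex $u$. A subtree of type $i$ is a maximal connected subgraph all of whose vertices have type $i$; the subforest $\mathbf f^{(i)}$ of type $i$ is the plane forest formed by the subtrees of type $i$ ranked according to the order of their roots in $\mathbf f$; $u^{(i)}_1,u^{(i)}_2,\dots$ are its vertices in its own breadth-first order. The root type sequence is $\mathrm c_{(\mathbf f,c_{\mathbf f})}=(c_{\mathbf f}(r(\mathbf t_1)),c_{\mathbf f}(r(\mathbf t_2)),\dots)$, $r(\mathbf t)$ the root of $\mathbf t$. $S_d$: families $x=(x^{(1)},\dots,x^{(d)})$, $x^{(i)}=(x^{i,1},\dots,x^{i,d})$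 a $\mathbb{Z}^d$-valued sequence indexed by $\{0,\dots,n_i\}$ ($0\le n_i\le\infty$), $x^{(i)}_0=0$, $x^{i,j}$ nondecreasing for $i\ne j$, $x^{i,i}_{n+1}-x^{i,i}_n\ge -1$; $(n_1,\dots,n_d)$ is its length; $x^{i,j}(n):=x^{i,j}_n$. $\Psi:\mathcal F_d\to S_d$ maps $(\mathbf f,c_{\mathbf f})$ to $x$ where $n_i$ is the number of vertices of $\mathbf f^{(i)}$, $x^{(i)}_0=0$, $x^{i,j}_{n+1}-x^{i,j}_n=p_j(u^{(i)}_{n+1})$ for $j\ne i$ and $x^{i,i}_{n+1}-x^{i,i}_n=p_i(u^{(i)}_{n+1})-1$, $0\le n\le n_i-1$. Coordinatewise order $\le$; $\mathrm q<\mathrm q'$ means $\mathrm q\le\mathrm q'$ and $\mathrm q\ne\mathrm q'$. A solution of $(\mathrm r,x)$ (for $x$ of length $\mathrm q$) is $\mathrm s\in\mathbb{Z}_+^d$, $\mathrm s\le\mathrm q$, with $r_j+\sum_ix^{i,j}(s_i)=0$ for all $j$; the smallest solution is a solution $\le$ every solution. $S_d^{\mathrm r}$ is the set of $x\in S_d$ whose length lies in $\mathbb{N}^d$ ($\mathbb N=\{1,2,\dots\}$) and is the smallest solution of $(\mathrm r,x)$. For $r=r_1+\dots+r_d$, $C_d^{\mathrm r}=\{c\in[d]^r:\#\{j\in[r]:c_j=i\}=r_i,\ i\in[d]\}$. $\mathcal F_d^{\mathrm r}$ is the set of $(\mathbf f,c_{\mathbf f})\in\mathcal F_d$ having $r_1+\dots+r_d$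 trees, containing at least one vertex of each type, and with root type sequence in $C_d^{\mathrm r}$. *)

theory Defs
  imports Main
begin

text \<open>A finite rooted plane tree whose vertices carry a label; the children of a
vertex are given as a list, from left to right. Unlabeled plane trees are exactly
these rose trees (up to labels), so no quotient is needed.\<close>

datatype 'a rtree = RNode (label: 'a) (kids: "'a rtree list")

fun height :: "'a rtree \<Rightarrow> nat" where
  "height (RNode a cs) = Suc (foldr max (map height cs) 0)"

text \<open>Vertices (as subtrees rooted at them) of generation k, from left to right.\<close>
fun gen :: "'a rtree \<Rightarrow> nat \<Rightarrow> 'a rtree list" where
  "gen t 0 = [t]"
| "gen (RNode a cs) (Suc k) = concat (map (\<lambda>c. gen c k) cs)"

definition bfs_tree :: "'a rtree \<Rightarrow> 'a rtree list" where
  "bfs_tree t = concat (map (gen t) [0..<height t])"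

definition bfs_forest :: "'a rtree list \<Rightarrow> 'a rtree list" where
  "bfs_forest ts = concat (map bfs_tree ts)"

definition dtype_forest :: "nat \<Rightarrow> nat rtree list \<Rightarrow> bool" where
  "dtype_forest d f \<longleftrightarrow>
     (\<forall>v\<in>set (bfs_forest f). label v \<in> {1..d} \<and> sorted (map label (kids v)))"

definition nchild :: "nat \<Rightarrow> nat rtree \<Rightarrow> nat" where
  "nchild j u = length (filter (\<lambda>c. label c = j) (kids u))"

fun ann :: "'a option \<Rightarrow> 'a rtree \<Rightarrow> ('a option \<times> 'a rtree) rtree" where
  "ann p (RNode a cs) = RNode (p, RNode a cs) (map (ann (Some a)) cs)"

text \<open>The maximal subtree of type i rooted at a vertex v of type i: its vertices are
(the vertices of f, represented by) the subtrees of f rooted at them, and the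
children of a vertex are its children of type i, in the same left-to-right order.\<close>
fun msub :: "'a \<Rightarrow> 'a rtree \<Rightarrow> 'a rtree rtree" where
  "msub i (RNode a cs) =
     RNode (RNode a cs) (concat (map (\<lambda>c. if label c = i then [msub i c] else []) cs))"

text \<open>The subforest of type i: the subtrees of type i ranked according to the order
of their roots in f (breadth-first order of f). A vertex is the root of a subtree of
type i iff it has type i and it is a root of f or its parent is not of type i.\<close>
definition subforest :: "nat \<Rightarrow> nat rtree list \<Rightarrow> nat rtree rtree list" where
  "subforest i f =
     map (\<lambda>(p, v). msub i v)
       (filter (\<lambda>(p, v). label v = i \<and> p \<noteq> Some i)
          (map label (bfs_forest (map (ann None) f))))"

text \<open>u^(i)_1, u^(i)_2, ...: the vertices of the subforest of type i in its own
breadth-first order (each given as the vertex of f it is, i.e. the subtree of f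
rooted at it). So u^(i)_(n+1) = sub_verts i f ! n.\<close>
definition sub_verts :: "nat \<Rightarrow> nat rtree list \<Rightarrow> nat rtree list" where
  "sub_verts i f = map label (bfs_forest (subforest i f))"

text \<open>An element x = (x^(1),...,x^(d)) with finite lengths is represented as a list
of d lists; x ! (i-1) is the sequence x^(i)_0, ..., x^(i)_(n_i) (length n_i+1), and
each x^(i)_n is a list of length d with x ! (i-1) ! n ! (j-1) = x^(i,j)_n.\<close>

definition xc :: "int list list list \<Rightarrow> nat \<Rightarrow> nat \<Rightarrow> nat \<Rightarrow> int" where
  "xc x i j n = x ! (i - 1) ! n ! (j - 1)"

definition xlen :: "int list list list \<Rightarrow> nat \<Rightarrow> nat" where
  "xlen x i = length (x ! (i - 1)) - 1"

definition in_Sd :: "nat \<Rightarrow> int list list list \<Rightarrow> bool" where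
  "in_Sd d x \<longleftrightarrow> length x = d \<and>
     (\<forall>i\<in>{1..d}. x ! (i - 1) \<noteq> [] \<and>
        (\<forall>n\<le>xlen x i. length (x ! (i - 1) ! n) = d) \<and>
        (\<forall>j\<in>{1..d}. xc x i j 0 = 0) \<and>
        (\<forall>j\<in>{1..d}. j \<noteq> i \<longrightarrow> (\<forall>n<xlen x i. xc x i j n \<le> xc x i j (Suc n))) \<and>
        (\<forall>n<xlen x i. xc x i i (Suc n) - xc x i i n \<ge> -1))"

text \<open>s is a solution of (r, x): s \<le> length of x and r_j + sum_i x^(i,j)(s_i) = 0.
Vectors of Z_+^d are functions nat => nat, only their values on {1..d} matter.\<close>
definition is_solution :: "nat \<Rightarrow> (nat \<Rightarrow> nat) \<Rightarrow> int list list list \<Rightarrow> (nat \<Rightarrow> nat) \<Rightarrow> bool" where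
  "is_solution d r x s \<longleftrightarrow>
     (\<forall>i\<in>{1..d}. s i \<le> xlen x i) \<and>
     (\<forall>j\<in>{1..d}. int (r j) + (\<Sum>i=1..d. xc x i j (s i)) = 0)"

definition smallest_solution :: "nat \<Rightarrow> (nat \<Rightarrow> nat) \<Rightarrow> int list list list \<Rightarrow> (nat \<Rightarrow> nat) \<Rightarrow> bool" where
  "smallest_solution d r x s \<longleftrightarrow> is_solution d r x s \<and>
     (\<forall>s'. is_solution d r x s' \<longrightarrow> (\<forall>i\<in>{1..d}. s i \<le> s' i))"

definition Sdr :: "nat \<Rightarrow> (nat \<Rightarrow> nat) \<Rightarrow> int list list list set" where
  "Sdr d r = {x. in_Sd d x \<and> (\<forall>i\<in>{1..d}. xlen x i \<ge> 1) \<and>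
                 smallest_solution d r x (xlen x)}"

definition Cdr :: "nat \<Rightarrow> (nat \<Rightarrow> nat) \<Rightarrow> nat list set" where
  "Cdr d r = {c. length c = (\<Sum>i=1..d. r i) \<and> set c \<subseteq> {1..d} \<and>
                 (\<forall>i\<in>{1..d}. count_list c i = r i)}"

definition Psi :: "nat \<Rightarrow> nat rtree list \<Rightarrow> int list list list" where
  "Psi d f = map (\<lambda>i. let us = sub_verts i f in
       map (\<lambda>n. map (\<lambda>j. \<Sum>m<n. int (nchild j (us ! m)) - (if i = j then 1 else 0)) [1..<Suc d])
           [0..<Suc (length us)])
     [1..<Suc d]"

definition root_types :: "nat rtree list \<Rightarrow> nat list" where
  "root_types f = map label f"

definition Phi :: "nat \<Rightarrow> nat rtree list \<Rightarrow> int list list list \<times> nat list" where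
  "Phi d f = (Psi d f, root_types f)"

text \<open>F_d^r: d-type forests with r_1+...+r_d trees, at least one vertex of each type,
and root type sequence in C_d^r. Such forests are finite, hence lists of trees.\<close>
definition Fdr :: "nat \<Rightarrow> (nat \<Rightarrow> nat) \<Rightarrow> nat rtree list set" where
  "Fdr d r = {f. dtype_forest d f \<and> length f = (\<Sum>i=1..d. r i) \<and>
                 (\<forall>i\<in>{1..d}. \<exists>v\<in>set (bfs_forest f). label v = i) \<and>
                 root_types f \<in> Cdr d r}"

end

theory Submission
  imports Defs "HOL-Library.Multiset" "HOL-Library.Sublist"
begin

text \<open>
  Label every vertex of a subtree of type \<open>i\<close> by the word of the types of all its children in the
  forest; call the result a skeleton. Reading the skeletons of type \<open>i\<close> breadth-first gives a list of
  words \<open>offspring_words f i\<close>, and \<open>Psi\<close> records the partial sums of the letter counts of these words.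

  A forest is rebuilt from its root types and, for each type, the queue of its skeletons: go through
  the vertices in breadth-first order, take the children of the parent's own type from the parent's
  skeleton and every other child from the head of the queue of its type. As this is deterministic, a
  forest is determined by its root types and its words, even if the words are only known to be
  comparable for the prefix order. Conversely, pad the queues with leaves so that they never run dry.
  If for every type the demand (the roots and letters of that type) is at most the supply (the words
  of that type), then counting the vertices of the resulting forest shows that no padding was used.

  A solution \<open>s\<close> of \<open>(r, x)\<close> says that among the words up to \<open>s\<close> supply equals demand. Every solution
  therefore yields a forest whose words are prefixes of the given ones and form a solution themselves,
  so that the words of a forest are exactly those families for which the full length is the smallest
  solution.
\<close>

section \<open>Breadth-first search by a queue\<close>

text \<open>\<open>bfs q ts\<close> lists the vertices still to be visited when \<open>q\<close> is the queue of the tree being explored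
and \<open>ts\<close> are the trees not yet begun.\<close>

function bfs :: "'a rtree list \<Rightarrow> 'a rtree list \<Rightarrow> 'a rtree list" where
  "bfs [] [] = []"
| "bfs [] (t # ts) = bfs [t] ts"
| "bfs (t # q) ts = t # bfs (q @ kids t) ts"
  by pat_completeness auto

lemma size_list_kids_less: "size_list size (kids t) < size t"
  by (cases t) simp

termination bfs
  by (relation "measures [\<lambda>(q, ts). length ts, \<lambda>(q, ts). size_list size q]")
    (auto intro: less_SucI size_list_kids_less)

lemma bfs_append_left: "bfs (us @ q) ts = us @ bfs (q @ concat (map kids us)) ts"
  by (induction us arbitrary: q) simp_all

lemma gen_Suc: "gen t (Suc k) = concat (map (\<lambda>c. gen c k) (kids t))"
  by (cases t) simp

lemma height_less_if_in_kids:
  assumes "c \<in> set (kids t)"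
  shows "height c < height t"
proof (cases t)
  case (RNode a cs)
  have "height c \<le> foldr max (map height cs) 0" if "c \<in> set cs"
    using that by (induction cs) auto
  then show ?thesis using assms RNode by auto
qed

lemma bfs_conv_gen:
  assumes "\<forall>t\<in>set q. height t \<le> h"
  shows "bfs q [] = concat (map (\<lambda>k. concat (map (\<lambda>t. gen t k) q)) [0..<h])"
  using assms
proof (induction h arbitrary: q)
  case 0
  have "height t > 0" for t :: "'a rtree" by (cases t) simp
  then have "q = []" using 0 by (metis le_zero_eq less_irrefl list.set_sel(1))
  then show ?case by simp
next
  case (Suc h)
  have "\<forall>t\<in>set (concat (map kids q)). height t \<le> h"
    using Suc.prems height_less_if_in_kids by fastforce
  then have "bfs (concat (map kids q)) [] =
      concat (map (\<lambda>k. concat (map (\<lambda>t. gen t k) (concat (map kids q)))) [0..<h])"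
    by (rule Suc.IH)
  moreover have "concat (map (\<lambda>t. gen t k) (concat (map kids q))) = concat (map (\<lambda>t. gen t (Suc k)) q)" for k
    by (induction q) (simp_all add: gen_Suc)
  ultimately have "bfs q [] = q @ concat (map (\<lambda>k. concat (map (\<lambda>t. gen t (Suc k)) q)) [0..<h])"
    using bfs_append_left[of q "[]" "[]"] by simp
  moreover have "concat (map (\<lambda>t. gen t 0) q) = q"
    by (induction q) simp_all
  ultimately show ?case
    by (simp add: upt_conv_Cons map_Suc_upt[symmetric] comp_def del: upt_Suc)
qed

lemma bfs_conv_bfs_forest: "bfs q ts = bfs q [] @ bfs_forest ts"
proof (induction q ts rule: bfs.induct)
  case (2 t ts)
  have "bfs [t] [] = bfs_tree t"
    using bfs_conv_gen[of "[t]" "height t"] by (simp add: bfs_tree_def)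
  then show ?case using 2 by (simp add: bfs_forest_def)
qed (simp_all add: bfs_forest_def)

lemma bfs_forest_conv_bfs: "bfs_forest ts = bfs [] ts"
  using bfs_conv_bfs_forest[of "[]" ts] by simp

lemma bfs_forest_append: "bfs_forest (ts @ us) = bfs_forest ts @ bfs_forest us"
  by (simp add: bfs_forest_def)

lemma map_label_bfs_map_rtree:
  "map label (bfs (map (map_rtree g) q) (map (map_rtree g) ts)) = map (g \<circ> label) (bfs q ts)"
  by (induction q ts rule: bfs.induct) (simp_all add: rtree.map_sel)

lemma mset_bfs: "mset (bfs q ts) = mset q + mset ts + mset (concat (map kids (bfs q ts)))"
  by (induction q ts rule: bfs.induct) simp_all

fun label_mset :: "'a rtree \<Rightarrow> 'a multiset" where
  "label_mset (RNode a cs) = add_mset a (\<Sum>c\<leftarrow>cs. label_mset c)"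

lemma label_mset_conv_kids: "label_mset t = add_mset (label t) (\<Sum>c\<leftarrow>kids t. label_mset c)"
  by (cases t) simp

lemma mset_map_label_bfs:
  "mset (map label (bfs q ts)) = (\<Sum>t\<leftarrow>q. label_mset t) + (\<Sum>t\<leftarrow>ts. label_mset t)"
proof (induction q ts rule: bfs.induct)
  case (3 t q ts)
  then show ?case using label_mset_conv_kids[of t] by simp
qed simp_all

section \<open>Subtrees of one type and their skeletons\<close>

abbreviation kids_of_type :: "'a \<Rightarrow> 'a rtree \<Rightarrow> 'a rtree list" where
  "kids_of_type j v \<equiv> filter (\<lambda>c. label c = j) (kids v)"

definition entering_kids :: "'a \<Rightarrow> 'a rtree \<Rightarrow> 'a rtree list" where
  "entering_kids j v = (if label v = j then [] else kids_of_type j v)"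

text \<open>The roots of the subtrees of type \<open>j\<close> found by \<open>bfs q ts\<close>, apart from those in \<open>q\<close>.\<close>

function sub_roots :: "'a \<Rightarrow> 'a rtree list \<Rightarrow> 'a rtree list \<Rightarrow> 'a rtree list" where
  "sub_roots j [] [] = []"
| "sub_roots j [] (t # ts) = (if label t = j then [t] else []) @ sub_roots j [t] ts"
| "sub_roots j (t # q) ts = entering_kids j t @ sub_roots j (q @ kids t) ts"
  by pat_completeness auto

termination sub_roots
  by (relation "measures [\<lambda>(j, q, ts). length ts, \<lambda>(j, q, ts). size_list size q]")
    (auto intro: less_SucI size_list_kids_less)

lemma label_sub_roots: "v \<in> set (sub_roots j q ts) \<Longrightarrow> label v = j"
  by (induction j q ts rule: sub_roots.induct) (auto simp: entering_kids_def split: if_splits)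

lemma label_ann: "label (ann p t) = (p, t)"
  by (cases t) simp

lemma kids_ann: "kids (ann p t) = map (ann (Some (label t))) (kids t)"
  by (cases t) simp

lemma sub_roots_conv_ann:
  fixes j :: 'a
  defines "select \<equiv> \<lambda>ps. map snd (filter (\<lambda>(p, v). label v = j \<and> p \<noteq> Some j) ps)"
  shows "select (map label (bfs (map (\<lambda>(p, t). ann p t) ps) (map (ann None) ts))) =
    select ps @ sub_roots j (map snd ps) ts"
proof -
  have select_Nil: "select [] = []" by (simp add: select_def)
  have select_Cons: "select ((p, v) # ps) = (if label v = j \<and> p \<noteq> Some j then [v] else []) @ select ps"
    for p v ps by (simp add: select_def)
  have select_append: "select (ps @ qs) = select ps @ select qs" for ps qs
    by (simp add: select_def)
  have select_kids: "select (map (Pair (Some (label t))) (kids t)) = entering_kids j t" for t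
    by (simp add: select_def entering_kids_def filter_map comp_def)
  show ?thesis
  proof (induction "map snd ps" ts arbitrary: ps rule: bfs.induct)
    case 1
    then show ?case by (simp add: select_Nil)
  next
    case (2 t ts)
    then show ?case using "2.hyps"(1)[of "[(None, t)]"] by (simp add: select_Nil select_Cons)
  next
    case (3 t q ts)
    then obtain p qs where ps: "ps = (p, t) # qs" and q: "q = map snd qs" by auto
    define ks where "ks = map (Pair (Some (label t))) (kids t)"
    have "select (map label (bfs (map (\<lambda>(p, t). ann p t) (qs @ ks)) (map (ann None) ts))) =
        select (qs @ ks) @ sub_roots j (map snd (qs @ ks)) ts"
      by (rule "3.hyps"(1)) (simp add: q ks_def comp_def)
    then show ?case
      by (simp add: ps ks_def label_ann kids_ann comp_def select_Cons select_append select_kids)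
  qed
qed

lemma subforest_conv_sub_roots: "subforest j f = map (msub j) (sub_roots j [] f)"
proof -
  have "map (\<lambda>(p, v). msub j v) ps = map (msub j) (map snd ps)" for ps :: "(nat option \<times> nat rtree) list"
    by (simp add: split_beta)
  then show ?thesis
    using sub_roots_conv_ann[of j "[]" f] by (simp add: subforest_def bfs_forest_conv_bfs del: map_map)
qed

definition offspring :: "'a rtree \<Rightarrow> 'a list" where
  "offspring v = map label (kids v)"

lemma count_list_offspring: "count_list (offspring v) j = length (kids_of_type j v)"
  by (simp add: offspring_def count_list_eq_length_filter comp_def eq_commute)

fun skeleton :: "'a rtree \<Rightarrow> 'a list rtree" where
  "skeleton (RNode a cs) = RNode (map label cs) (map skeleton (filter (\<lambda>c. label c = a) cs))"

lemma label_skeleton: "label (skeleton t) = offspring t"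
  by (cases t) (simp add: offspring_def)

lemma offspring_eq_if_skeleton_eq: "skeleton t = skeleton t' \<Longrightarrow> offspring t = offspring t'"
  by (simp flip: label_skeleton)

lemma kids_skeleton: "kids (skeleton t) = map skeleton (kids_of_type (label t) t)"
  by (cases t) simp

lemma map_rtree_offspring_msub: "label v = i \<Longrightarrow> map_rtree offspring (msub i v) = skeleton v"
proof (induction v)
  case (RNode a cs)
  have "concat (map (\<lambda>c. if label c = i then [msub i c] else []) cs) =
      map (msub i) (filter (\<lambda>c. label c = i) cs)"
    by (induction cs) simp_all
  then show ?case using RNode by (simp add: offspring_def)
qed

definition offspring_words :: "nat rtree list \<Rightarrow> nat \<Rightarrow> nat list list" where
  "offspring_words f j = map offspring (sub_verts j f)"

lemma offspring_words_conv_skeleton: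
  "offspring_words f j = map label (bfs_forest (map skeleton (sub_roots j [] f)))"
proof -
  have "map skeleton (sub_roots j [] f) = map (map_rtree offspring) (subforest j f)"
    by (simp add: subforest_conv_sub_roots map_rtree_offspring_msub label_sub_roots)
  then show ?thesis
    using map_label_bfs_map_rtree[of offspring "[]" "subforest j f"]
    by (simp add: offspring_words_def sub_verts_def bfs_forest_conv_bfs)
qed

fun is_skeleton :: "'a \<Rightarrow> 'a list rtree \<Rightarrow> bool" where
  "is_skeleton i (RNode w ks) \<longleftrightarrow> length ks = count_list w i \<and> (\<forall>k\<in>set ks. is_skeleton i k)"

lemma length_kids_is_skeleton: "is_skeleton i t \<Longrightarrow> length (kids t) = count_list (label t) i"
  by (cases t) simp

lemma is_skeleton_kids: "is_skeleton i t \<Longrightarrow> k \<in> set (kids t) \<Longrightarrow> is_skeleton i k"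
  by (cases t) simp

lemma is_skeleton_skeleton: "is_skeleton (label t) (skeleton t)"
  by (induction t) (auto simp: count_list_eq_length_filter comp_def eq_commute)

section \<open>Uniqueness\<close>

lemma not_parallel_append_iff:
  assumes "length xs = length ys"
  shows "\<not> xs @ xs' \<parallel> ys @ ys' \<longleftrightarrow> xs = ys \<and> \<not> xs' \<parallel> ys'"
  using assms by (induction xs ys rule: list_induct2) (auto simp: parallel_def)

lemma map_eq_by_filter:
  assumes "map k xs = map k ys"
    and "\<And>j. map g (filter (\<lambda>x. k x = j) xs) = map g (filter (\<lambda>y. k y = j) ys)"
  shows "map g xs = map g ys"
  using assms
proof (induction xs arbitrary: ys)
  case (Cons x xs)
  then obtain y ys' where ys: "ys = y # ys'" "k x = k y" "map k xs = map k ys'"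
    by (cases ys) auto
  have "g x = g y" using Cons.prems(2)[of "k x"] ys by simp
  moreover have "map g (filter (\<lambda>x. k x = j) xs) = map g (filter (\<lambda>y. k y = j) ys')" for j
    using Cons.prems(2)[of j] ys by (simp split: if_splits)
  ultimately show ?case using Cons.IH ys by simp
qed simp

lemma length_entering_kids_eq:
  assumes "label t = label t'" "skeleton t = skeleton t'"
  shows "length (entering_kids j t) = length (entering_kids j t')"
proof -
  have "length (kids_of_type j t) = length (kids_of_type j t')"
    using offspring_eq_if_skeleton_eq[OF assms(2)] by (simp flip: count_list_offspring)
  then show ?thesis using assms(1) by (simp add: entering_kids_def)
qed

lemma map_skeleton_kids_eq:
  assumes "label t = label t'" "skeleton t = skeleton t'"
    and entering: "\<And>j. map skeleton (entering_kids j t) = map skeleton (entering_kids j t')"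
  shows "map skeleton (kids t) = map skeleton (kids t')"
proof (rule map_eq_by_filter)
  show "map label (kids t) = map label (kids t')"
    using offspring_eq_if_skeleton_eq[OF assms(2)] by (simp add: offspring_def)
  fix j
  show "map skeleton (kids_of_type j t) = map skeleton (kids_of_type j t')"
  proof (cases "label t = j")
    case True
    then show ?thesis using assms(1,2) kids_skeleton by metis
  next
    case False
    then show ?thesis using entering[of j] assms(1) by (simp add: entering_kids_def)
  qed
qed

lemma sub_roots_unique:
  assumes "map label q = map label q'" "map skeleton q = map skeleton q'"
    and "map label ts = map label ts'"
    and "\<And>j. \<not> map skeleton (sub_roots j q ts) \<parallel> map skeleton (sub_roots j q' ts')"
  shows "q = q' \<and> ts = ts'"
  using assms
proof (induction q ts arbitrary: q' ts' rule: bfs.induct)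
  case (2 t ts)
  then obtain t' us where q': "q' = []" and ts': "ts' = t' # us"
    and label: "label t' = label t" "map label us = map label ts"
    by (cases ts') auto
  have roots: "map skeleton (if label t = j then [t] else []) = map skeleton (if label t = j then [t'] else [])"
    and rest: "\<not> map skeleton (sub_roots j [t] ts) \<parallel> map skeleton (sub_roots j [t'] us)" for j
    using "2.prems"(4)[of j] not_parallel_append_iff[of "map skeleton (if label t = j then [t] else [])"
        "map skeleton (if label t = j then [t'] else [])"]
    by (simp_all add: q' ts' label(1))
  have "skeleton t = skeleton t'"
    using roots[of "label t"] by simp
  then have "[t] = [t'] \<and> ts = us"
    using label rest by (intro "2.IH") simp_all
  then show ?case by (simp add: q' ts')
next
  case (3 t q ts)
  then obtain t' p where q': "q' = t' # p" and t': "label t = label t'" "skeleton t = skeleton t'"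
    and p: "map label q = map label p" "map skeleton q = map skeleton p"
    by (cases q') auto
  have entering: "map skeleton (entering_kids j t) = map skeleton (entering_kids j t')"
    and rest: "\<not> map skeleton (sub_roots j (q @ kids t) ts) \<parallel> map skeleton (sub_roots j (p @ kids t') ts')" for j
    using "3.prems"(4)[of j] not_parallel_append_iff[of "map skeleton (entering_kids j t)"
        "map skeleton (entering_kids j t')"] length_entering_kids_eq[OF t', of j]
    by (simp_all add: q')
  have "map skeleton (kids t) = map skeleton (kids t')"
    using t' entering by (rule map_skeleton_kids_eq)
  moreover have "map label (kids t) = map label (kids t')"
    using offspring_eq_if_skeleton_eq[OF t'(2)] by (simp add: offspring_def)
  ultimately have "q @ kids t = p @ kids t' \<and> ts = ts'"
    using "3.prems"(3) p rest by (intro "3.IH") simp_all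
  moreover have "length q = length p" using p(1) by (metis length_map)
  ultimately show ?case using t'(1) q' by (simp add: rtree.expand)
qed simp_all

lemma bfs_skeletons_unique:
  assumes "length q = length q'"
    and "\<forall>t\<in>set q \<union> set q' \<union> set ts \<union> set ts'. is_skeleton i t"
    and "\<not> map label (bfs q ts) \<parallel> map label (bfs q' ts')"
  shows "q = q' \<and> \<not> ts \<parallel> ts'"
  using assms
proof (induction q ts arbitrary: q' ts' rule: bfs.induct)
  case (2 t ts)
  show ?case
  proof (cases ts')
    case (Cons t' us)
    then have "[t] = [t'] \<and> \<not> ts \<parallel> us"
      using "2.prems" by (intro "2.IH") simp_all
    then show ?thesis using 2 Cons by (auto simp: parallel_def)
  qed (use 2 in simp)
next
  case (3 t q ts)
  then obtain t' p where q': "q' = t' # p" by (cases q') auto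
  have label: "label t = label t'" and rest: "\<not> map label (bfs (q @ kids t) ts) \<parallel> map label (bfs (p @ kids t') ts')"
    using "3.prems"(3) by (auto simp: q' parallel_def)
  have skel: "is_skeleton i t" "is_skeleton i t'" using "3.prems"(2) q' by simp_all
  then have len: "length (kids t) = length (kids t')"
    using label by (simp add: length_kids_is_skeleton)
  have "q @ kids t = p @ kids t' \<and> \<not> ts \<parallel> ts'"
    using "3.prems"(1,2) skel rest len is_skeleton_kids by (intro "3.IH") (auto simp: q')
  then show ?case using label len q' by (simp add: rtree.expand)
qed simp_all

lemma offspring_words_unique:
  assumes "root_types f = root_types f'"
    and "\<And>j. \<not> offspring_words f j \<parallel> offspring_words f' j"
  shows "f = f'"
proof -
  have skel: "\<forall>t\<in>set (map skeleton (sub_roots j [] g)). is_skeleton j t" for j g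
    using is_skeleton_skeleton label_sub_roots by fastforce
  have "\<not> map skeleton (sub_roots j [] f) \<parallel> map skeleton (sub_roots j [] f')" for j
    using bfs_skeletons_unique[of "[]" "[]" "map skeleton (sub_roots j [] f)"
        "map skeleton (sub_roots j [] f')" j] skel[of j] assms(2)[of j]
    by (simp add: offspring_words_conv_skeleton bfs_forest_conv_bfs ball_Un)
  then show ?thesis
    using sub_roots_unique[of "[]" "[]" f f'] assms(1) by (simp add: root_types_def)
qed

section \<open>Existence with padding\<close>

abbreviation leaf :: "'a list rtree" where
  "leaf \<equiv> RNode [] []"

definition prefix_padded :: "'a \<Rightarrow> 'a list \<Rightarrow> 'a list \<Rightarrow> bool" where
  "prefix_padded z xs ys \<longleftrightarrow> (\<exists>n. prefix xs (ys @ replicate n z))"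

lemma prefix_padded_Nil [simp]: "prefix_padded z [] ys"
  by (simp add: prefix_padded_def)

lemma prefix_padded_Cons [simp]:
  "prefix_padded z (x # xs) ys \<longleftrightarrow> x = hd (ys @ [z]) \<and> prefix_padded z xs (tl ys)"
proof (cases ys)
  case Nil
  have "(\<exists>n. prefix (x # xs) (replicate n z)) \<longleftrightarrow> x = z \<and> (\<exists>n. prefix xs (replicate n z))"
    by (metis Cons_prefix_Cons prefix_Nil replicate_0 replicate_Suc list.distinct(1) not0_implies_Suc)
  then show ?thesis using Nil by (simp add: prefix_padded_def)
qed (auto simp: prefix_padded_def)

lemma prefix_padded_append:
  "prefix_padded z (xs @ us) ys \<longleftrightarrow> prefix_padded z xs ys \<and> prefix_padded z us (drop (length xs) ys)"
  by (induction xs arbitrary: ys) (simp_all add: drop_Suc)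

lemma set_prefix_padded: "prefix_padded z xs ys \<Longrightarrow> set xs \<subseteq> insert z (set ys)"
  unfolding prefix_padded_def by (auto dest!: set_mono_prefix split: if_splits)

lemma prefix_padded_concat:
  assumes "prefix_padded [] xss yss"
  shows "prefix (concat xss) (concat yss)"
proof -
  obtain n zss where "yss @ replicate n [] = xss @ zss"
    using assms by (auto simp: prefix_padded_def prefix_def)
  then have "concat (yss @ replicate n []) = concat xss @ concat zss" by simp
  then show ?thesis by simp
qed

lemma skeletons_of_words_exist:
  "\<exists>q ts n. length q = m \<and> (\<forall>t\<in>set q \<union> set ts. is_skeleton i t) \<and>
     map label (bfs q ts) = ws @ replicate n []"
proof (induction ws arbitrary: m)
  case Nil
  let ?q = "replicate m leaf :: 'a list rtree list"
  have "map label (bfs ?q []) = [] @ replicate m []"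
    using bfs_append_left[of ?q "[]" "[]"] by simp
  moreover have "length ?q = m" "\<forall>t\<in>set ?q \<union> set []. is_skeleton i t" by auto
  ultimately show ?case by blast
next
  case (Cons w ws)
  obtain q ts n where q: "length q = (m - 1) + count_list w i" "\<forall>t\<in>set q \<union> set ts. is_skeleton i t"
      "map label (bfs q ts) = ws @ replicate n []"
    using Cons.IH by blast
  define t where "t = RNode w (drop (m - 1) q)"
  have t: "is_skeleton i t" using q(1,2) by (auto simp: t_def dest: in_set_dropD)
  show ?case
  proof (cases m)
    case 0
    then have "map label (bfs [] (t # ts)) = (w # ws) @ replicate n []"
      using q(3) by (simp add: t_def)
    moreover have "length [] = m" "\<forall>s\<in>set [] \<union> set (t # ts). is_skeleton i s"
      using 0 q(2) t by simp_all
    ultimately show ?thesis by blast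
  next
    case (Suc k)
    then have "map label (bfs (t # take k q) ts) = (w # ws) @ replicate n []"
      using q(3) by (simp add: t_def)
    moreover have "length (t # take k q) = m" "\<forall>s\<in>set (t # take k q) \<union> set ts. is_skeleton i s"
      using Suc q(1,2) t by (auto dest: in_set_takeD)
    ultimately show ?thesis by blast
  qed
qed

text \<open>The queues of all letters are interleaved in one list, so that their total weight is a finite sum.\<close>

definition queue :: "('a \<times> 'b) list \<Rightarrow> 'a \<Rightarrow> 'b list" where
  "queue A j = map snd (filter (\<lambda>p. fst p = j) A)"

lemma queue_Nil [simp]: "queue [] j = []"
  by (simp add: queue_def)

lemma queue_Cons [simp]: "queue (p # A) j = (if fst p = j then [snd p] else []) @ queue A j"
  by (simp add: queue_def)

lemma queue_append [simp]: "queue (A @ B) j = queue A j @ queue B j"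
  by (simp add: queue_def)

lemma queue_map_Pair: "queue (map (Pair i) xs) j = (if i = j then xs else [])"
  by (simp add: queue_def filter_map comp_def)

lemma queue_map_label: "queue (map (\<lambda>t. (label t, g t)) ts) j = map g (filter (\<lambda>t. label t = j) ts)"
  by (simp add: queue_def filter_map comp_def)

lemma in_set_queue_iff [simp]: "x \<in> set (queue A j) \<longleftrightarrow> (j, x) \<in> set A"
  by (force simp: queue_def)

lemma queue_eq_Nil_iff: "queue A j = [] \<longleftrightarrow> j \<notin> fst ` set A"
  by (auto simp: queue_def filter_empty_conv)

lemma length_queue: "length (queue A j) = count_list (map fst A) j"
  by (induction A) auto

lemma queues_interleave:
  assumes "finite I" "\<And>i. i \<notin> I \<Longrightarrow> Q i = []"
  shows "\<exists>A. queue A = Q"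
proof -
  obtain xs where xs: "set xs = I" "distinct xs"
    using finite_distinct_list[OF assms(1)] by blast
  have "queue (concat (map (\<lambda>i. map (Pair i) (Q i)) xs)) j = (if j \<in> set xs then Q j else [])" for j
    using xs(2) by (induction xs) (auto simp: queue_map_Pair)
  then have "queue (concat (map (\<lambda>i. map (Pair i) (Q i)) xs)) = Q"
    using xs(1) assms(2) by (intro ext) simp
  then show ?thesis by blast
qed

lemma queue_pop_exists:
  fixes h :: "'b \<Rightarrow> nat"
  shows "\<exists>A'. queue A' = (queue A)(a := tl (queue A a)) \<and>
    (\<Sum>p\<leftarrow>A'. h (snd p)) + h (hd (queue A a @ [z])) \<le> (\<Sum>p\<leftarrow>A. h (snd p)) + h z"
proof (cases "a \<in> fst ` set A")
  case True
  then obtain x A1 A2 where A: "A = A1 @ (a, x) # A2" "a \<notin> fst ` set A1"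
    using split_list_first_prop[of A "\<lambda>p. fst p = a"] by fastforce
  then have "queue A1 a = []" by (simp add: queue_eq_Nil_iff)
  then have "queue (A1 @ A2) = (queue A)(a := tl (queue A a))"
    and "(\<Sum>p\<leftarrow>A1 @ A2. h (snd p)) + h (hd (queue A a @ [z])) \<le> (\<Sum>p\<leftarrow>A. h (snd p)) + h z"
    by (simp_all add: A(1) fun_eq_iff)
  then show ?thesis by blast
next
  case False
  then have "queue A a = []" by (simp add: queue_eq_Nil_iff)
  then show ?thesis by (intro exI[of _ A]) auto
qed

text \<open>Reading the word \<open>w\<close>, each letter \<open>j\<close> takes the next element of the queue of \<open>j\<close>, or \<open>z\<close> if that queue is
exhausted; \<open>M\<close> records what is taken and \<open>A'\<close> holds what is left.\<close>

definition draws :: "'b \<Rightarrow> ('a \<times> 'b) list \<Rightarrow> 'a list \<Rightarrow> ('a \<times> 'b) list \<Rightarrow> ('a \<times> 'b) list \<Rightarrow> bool" where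
  "draws z A w M A' \<longleftrightarrow> map fst M = w \<and>
     (\<forall>j. prefix_padded z (queue M j) (queue A j) \<and> queue A' j = drop (count_list w j) (queue A j))"

lemma length_queue_draws: "draws z A w M A' \<Longrightarrow> length (queue M j) = count_list w j"
  by (auto simp: draws_def length_queue)

lemma prefix_padded_draws:
  "draws z A w M A' \<Longrightarrow>
     prefix_padded z (queue M j @ xs) (queue A j) \<longleftrightarrow> prefix_padded z xs (queue A' j)"
  by (auto simp: prefix_padded_append length_queue_draws) (auto simp: draws_def)

lemma set_draws:
  assumes "draws z A w M A'" "(j, x) \<in> set (M @ A')"
  shows "(j, x) \<in> set A \<or> x = z"
proof -
  have "set (queue M j) \<subseteq> insert z (set (queue A j))" "set (queue A' j) \<subseteq> set (queue A j)"
    using assms(1) by (simp_all add: draws_def set_prefix_padded set_drop_subset)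
  then show ?thesis using assms(2) by (auto simp flip: in_set_queue_iff)
qed

lemma queue_draws_exactly:
  assumes "draws z (map (Pair i) xs @ A) w M A'" "length xs = count_list w i"
  shows "queue M i = xs" "queue A' i = queue A i"
proof -
  have "prefix_padded z (queue M i) (queue (map (Pair i) xs @ A) i)"
    using assms(1) unfolding draws_def by blast
  then obtain n ys where "(xs @ queue A i) @ replicate n z = queue M i @ ys"
    by (auto simp: queue_map_Pair prefix_padded_def prefix_def)
  moreover have "length (queue M i) = length xs"
    using assms by (simp add: length_queue_draws)
  ultimately show "queue M i = xs" by simp
  show "queue A' i = queue A i"
    using assms by (simp add: draws_def queue_map_Pair)
qed

lemma draws_exists:
  fixes h :: "'b \<Rightarrow> nat"
  shows "\<exists>M A'. draws z A w M A' \<and> (\<Sum>p\<leftarrow>M @ A'. h (snd p)) \<le> (\<Sum>p\<leftarrow>A. h (snd p)) + length w * h z"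
proof (induction w arbitrary: A)
  case Nil
  have "draws z A [] [] A" by (simp add: draws_def)
  moreover have "(\<Sum>p\<leftarrow>[] @ A. h (snd p)) \<le> (\<Sum>p\<leftarrow>A. h (snd p)) + length [] * h z" by simp
  ultimately show ?case by blast
next
  case (Cons a w)
  let ?x = "hd (queue A a @ [z])"
  obtain A1 where A1: "queue A1 = (queue A)(a := tl (queue A a))"
      "(\<Sum>p\<leftarrow>A1. h (snd p)) + h ?x \<le> (\<Sum>p\<leftarrow>A. h (snd p)) + h z"
    using queue_pop_exists[of A a h z] by blast
  obtain M A' where M: "draws z A1 w M A'"
      "(\<Sum>p\<leftarrow>M @ A'. h (snd p)) \<le> (\<Sum>p\<leftarrow>A1. h (snd p)) + length w * h z"
    using Cons.IH[of A1] by blast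
  have rest: "prefix_padded z (queue M j) (queue A1 j) \<and> queue A' j = drop (count_list w j) (queue A1 j)" for j
    using M(1) unfolding draws_def by blast
  have "prefix_padded z (queue ((a, ?x) # M) j) (queue A j) \<and>
      queue A' j = drop (count_list (a # w) j) (queue A j)" for j
    using rest[of j] by (auto simp: A1(1) drop_Suc)
  then have "draws z A (a # w) ((a, ?x) # M) A'"
    using M(1) by (simp add: draws_def)
  moreover have "(\<Sum>p\<leftarrow>((a, ?x) # M) @ A'. h (snd p)) \<le> (\<Sum>p\<leftarrow>A. h (snd p)) + length (a # w) * h z"
    using M(2) A1(2) by simp
  ultimately show ?case by blast
qed

text \<open>\<open>N\<close> lists the types and skeletons of the vertices in the queue \<open>q\<close>, and every other subtree met by \<open>bfs q f\<close>
takes its skeleton from \<open>A\<close>.\<close>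

definition assembles :: "('a \<times> 'a list rtree) list \<Rightarrow> 'a list \<Rightarrow> ('a \<times> 'a list rtree) list \<Rightarrow>
    'a rtree list \<Rightarrow> 'a rtree list \<Rightarrow> bool" where
  "assembles N c A q f \<longleftrightarrow> map (\<lambda>t. (label t, skeleton t)) q = N \<and> map label f = c \<and>
     (\<forall>j. prefix_padded leaf (map skeleton (sub_roots j q f)) (queue A j))"

lemma assembles_new_tree:
  assumes "draws leaf A [a] M A'" "assembles M c A' q f"
  shows "\<exists>f'. assembles [] (a # c) A [] f'"
proof -
  obtain t where t: "q = [t]" "label t = a" "M = [(a, skeleton t)]"
    using assms by (auto simp: assembles_def draws_def)
  have "prefix_padded leaf (queue M j @ map skeleton (sub_roots j [t] f)) (queue A j)" for j
    using assms(2) t(1) by (simp add: prefix_padded_draws[OF assms(1)] assembles_def)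
  moreover have "queue M j = (if label t = j then [skeleton t] else [])" for j
    using t by simp
  ultimately have "prefix_padded leaf (map skeleton (sub_roots j [] (t # f))) (queue A j)" for j
    by (simp del: sub_roots.simps add: sub_roots.simps(2) if_distrib[of "map skeleton"] cong: if_cong)
  then have "assembles [] (a # c) A [] (t # f)"
    using assms(2) t(2) by (simp add: assembles_def)
  then show ?thesis by blast
qed

lemma assembles_new_vertex:
  assumes draws: "draws leaf (map (Pair i) ks @ A) w M A'" and ks: "length ks = count_list w i"
    and "assembles (N @ M) c A' q f"
  shows "\<exists>q'. assembles ((i, RNode w ks) # N) c A q' f"
proof -
  obtain us cs where q: "q = us @ cs" and us: "map (\<lambda>t. (label t, skeleton t)) us = N"
    and cs: "map (\<lambda>t. (label t, skeleton t)) cs = M"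
    using assms(3) by (auto simp: assembles_def map_eq_append_conv)
  have rest: "prefix_padded leaf (map skeleton (sub_roots j q f)) (queue A' j)" for j
    using assms(3) by (simp add: assembles_def)
  let ?v = "RNode i cs"
  have queue_M: "map skeleton (kids_of_type j ?v) = queue M j" for j
    by (simp flip: cs add: queue_map_label)
  have "map label cs = w" using draws by (auto simp flip: cs simp: draws_def comp_def)
  then have "skeleton ?v = RNode w ks"
    using queue_M[of i] queue_draws_exactly(1)[OF draws ks] by simp
  moreover have "prefix_padded leaf (map skeleton (sub_roots j (?v # us) f)) (queue A j)" for j
  proof (cases "j = i")
    case True
    then show ?thesis
      using rest[of i] queue_draws_exactly(2)[OF draws ks] by (simp add: q entering_kids_def)
  next
    case False
    then show ?thesis
      using rest[of j] prefix_padded_draws[OF draws, of j "map skeleton (sub_roots j q f)"] queue_M[of j]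
      by (simp add: entering_kids_def queue_map_Pair q)
  qed
  ultimately have "assembles ((i, RNode w ks) # N) c A (?v # us) f"
    using assms(3) us by (simp add: assembles_def del: skeleton.simps)
  then show ?thesis by blast
qed

text \<open>Each leaf used as padding is paid for by a letter, hence the weight of a vertex.\<close>

abbreviation weight :: "'a list rtree \<Rightarrow> nat" where
  "weight \<equiv> size_rtree length"

lemma draws_skeletons_exist:
  fixes A :: "('a \<times> 'a list rtree) list"
  assumes "\<forall>(i, t)\<in>set A. is_skeleton i t"
  shows "\<exists>M A'. draws leaf A w M A' \<and> (\<forall>(i, t)\<in>set (M @ A'). is_skeleton i t) \<and>
    (\<Sum>p\<leftarrow>M @ A'. weight (snd p)) \<le> (\<Sum>p\<leftarrow>A. weight (snd p)) + length w"
proof -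
  obtain M A' where M: "draws leaf A w M A'"
      "(\<Sum>p\<leftarrow>M @ A'. weight (snd p)) \<le> (\<Sum>p\<leftarrow>A. weight (snd p)) + length w"
    using draws_exists[where z = leaf and A = A and w = w and h = weight] by auto
  have "\<forall>(i, t)\<in>set (M @ A'). is_skeleton i t"
    using set_draws[OF M(1)] assms by fastforce
  then show ?thesis using M by blast
qed

lemma assembles_exists:
  fixes N A :: "('a \<times> 'a list rtree) list"
  assumes "\<forall>(i, t)\<in>set (N @ A). is_skeleton i t"
  shows "\<exists>q f. assembles N c A q f"
  using assms
proof (induction "(\<Sum>p\<leftarrow>N @ A. weight (snd p)) + 2 * length c" arbitrary: N A c rule: less_induct)
  case less
  consider "N = []" "c = []" | a c' where "N = []" "c = a # c'" | i w ks N' where "N = (i, RNode w ks) # N'"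
    by (metis neq_Nil_conv prod.exhaust rtree.exhaust)
  then show ?case
  proof cases
    case 1
    then have "assembles N c A [] []" by (simp add: assembles_def)
    then show ?thesis by blast
  next
    case 2
    obtain M A' where M: "draws leaf A [a] M A'" "\<forall>(i, t)\<in>set (M @ A'). is_skeleton i t"
        "(\<Sum>p\<leftarrow>M @ A'. weight (snd p)) \<le> (\<Sum>p\<leftarrow>A. weight (snd p)) + length [a]"
      using draws_skeletons_exist[of A "[a]"] less.prems 2 by auto
    then obtain q f where "assembles M c' A' q f"
      using less.hyps[of M A' c'] 2 by auto
    then show ?thesis using assembles_new_tree[OF M(1)] 2 by blast
  next
    case 3
    have ks: "length ks = count_list w i" and "\<forall>(i, t)\<in>set (map (Pair i) ks @ A). is_skeleton i t"
      using less.prems 3 by auto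
    then obtain M A' where M: "draws leaf (map (Pair i) ks @ A) w M A'" "\<forall>(i, t)\<in>set (M @ A'). is_skeleton i t"
        "(\<Sum>p\<leftarrow>M @ A'. weight (snd p)) \<le> (\<Sum>p\<leftarrow>map (Pair i) ks @ A. weight (snd p)) + length w"
      using draws_skeletons_exist by blast
    have "(\<Sum>p\<leftarrow>(N' @ M) @ A'. weight (snd p)) < (\<Sum>p\<leftarrow>N @ A. weight (snd p))"
      using M(3) 3 by (simp add: comp_def size_list_conv_sum_list)
    moreover have "\<forall>(i, t)\<in>set ((N' @ M) @ A'). is_skeleton i t"
      using less.prems M(2) 3 by auto
    ultimately obtain q f where "assembles (N' @ M) c A' q f"
      using less.hyps[of "N' @ M" A' c] by auto
    then show ?thesis using assembles_new_vertex[OF M(1) ks] 3 by blast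
  qed
qed

lemma prefix_padded_bfs_forest:
  assumes "prefix_padded leaf us ts" "map label (bfs_forest ts) = ws @ replicate m []"
  shows "prefix_padded [] (map label (bfs_forest us)) ws"
proof -
  obtain n vs where "ts @ replicate n leaf = us @ vs"
    using assms(1) by (auto simp: prefix_padded_def prefix_def)
  then have "map label (bfs_forest ts) @ map label (bfs_forest (replicate n leaf)) =
      map label (bfs_forest us) @ map label (bfs_forest vs)"
    by (metis bfs_forest_append map_append)
  moreover have "map label (bfs_forest (replicate n leaf)) = replicate n ([] :: 'a list)"
    by (induction n) (simp_all add: bfs_forest_conv_bfs)
  ultimately have "ws @ replicate (m + n) [] = map label (bfs_forest us) @ map label (bfs_forest vs)"
    using assms(2) by (simp add: replicate_add)
  then show ?thesis unfolding prefix_padded_def prefix_def by blast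
qed

lemma forest_with_padded_words_exists:
  assumes "finite I" "\<And>i. i \<notin> I \<Longrightarrow> ws i = []"
  shows "\<exists>f. root_types f = c \<and> (\<forall>j. prefix_padded [] (offspring_words f j) (ws j))"
proof -
  have "\<exists>ts n. (\<forall>t\<in>set ts. is_skeleton i t) \<and> map label (bfs_forest ts) = ws i @ replicate n []" for i
    using skeletons_of_words_exist[of 0 i "ws i"] by (auto simp: bfs_forest_conv_bfs)
  then obtain Q n where Q: "\<And>i t. t \<in> set (Q i) \<Longrightarrow> is_skeleton i t"
      "\<And>i. map label (bfs_forest (Q i)) = ws i @ replicate (n i) []"
    by metis
  obtain A where A: "queue A = (\<lambda>i. if i \<in> I then Q i else [])"
    using queues_interleave[OF assms(1), of "\<lambda>i. if i \<in> I then Q i else []"] by auto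
  have "is_skeleton i t" if "(i, t) \<in> set A" for i t
  proof -
    have "t \<in> set (queue A i)" using that by simp
    then show ?thesis using Q(1) by (simp add: A split: if_splits)
  qed
  then obtain f where f: "map label f = c"
      "\<And>j. prefix_padded leaf (map skeleton (sub_roots j [] f)) (queue A j)"
    using assembles_exists[of "[]" A c] by (auto simp: assembles_def)
  have "map label (bfs_forest (queue A j)) = ws j @ replicate (if j \<in> I then n j else 0) []" for j
    using Q(2) assms(2) by (simp add: A bfs_forest_conv_bfs)
  then have "prefix_padded [] (offspring_words f j) (ws j)" for j
    unfolding offspring_words_conv_skeleton by (rule prefix_padded_bfs_forest[OF f(2)])
  then show ?thesis using f(1) by (auto simp: root_types_def)
qed

section \<open>Counting vertices by type\<close>

lemma label_mset_skeleton:
  "label_mset (skeleton t) = add_mset (offspring t) (\<Sum>c\<leftarrow>kids_of_type (label t) t. label_mset (skeleton c))"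
  by (simp add: label_mset_conv_kids[of "skeleton t"] label_skeleton kids_skeleton comp_def)

lemma mset_offspring_bfs:
  "mset (map offspring (filter (\<lambda>v. label v = i) (bfs q ts))) =
     (\<Sum>t\<leftarrow>filter (\<lambda>t. label t = i) q. label_mset (skeleton t)) +
     (\<Sum>t\<leftarrow>sub_roots i q ts. label_mset (skeleton t))"
proof (induction q ts rule: bfs.induct)
  case (3 t q ts)
  then show ?case by (simp add: entering_kids_def label_mset_skeleton[of t])
qed simp_all

lemma mset_offspring_words:
  "mset (offspring_words f i) = mset (map offspring (filter (\<lambda>v. label v = i) (bfs_forest f)))"
  using mset_offspring_bfs[of i "[]" f] mset_map_label_bfs[of "[]" "map skeleton (sub_roots i [] f)"]
  by (simp add: offspring_words_conv_skeleton bfs_forest_conv_bfs comp_def del: mset_map)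

lemma set_offspring_words:
  "set (offspring_words f i) = offspring ` {v \<in> set (bfs_forest f). label v = i}"
  using arg_cong[OF mset_offspring_words[of f i], of set_mset] by simp

lemma offspring_words_eq_Nil_iff:
  "offspring_words f i = [] \<longleftrightarrow> (\<forall>v\<in>set (bfs_forest f). label v \<noteq> i)"
  using set_offspring_words[of f i] by (auto simp flip: set_empty)

lemma sum_list_filter_partition:
  fixes g :: "'a \<Rightarrow> 'b::comm_monoid_add"
  assumes "finite I" "k ` set xs \<subseteq> I"
  shows "(\<Sum>i\<in>I. \<Sum>x\<leftarrow>filter (\<lambda>x. k x = i) xs. g x) = (\<Sum>x\<leftarrow>xs. g x)"
  using assms(2)
proof (induction xs)
  case (Cons x xs)
  have "(\<Sum>i\<in>I. \<Sum>y\<leftarrow>filter (\<lambda>y. k y = i) (x # xs). g y) =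
      (\<Sum>i\<in>I. (if i = k x then g x else 0) + (\<Sum>y\<leftarrow>filter (\<lambda>y. k y = i) xs. g y))"
    by (rule sum.cong) auto
  then show ?case using Cons assms(1) by (simp add: sum.distrib)
qed simp

lemma count_list_concat_offspring_words:
  "count_list (concat (offspring_words f i)) j =
     (\<Sum>v\<leftarrow>filter (\<lambda>v. label v = i) (bfs_forest f). count_list (offspring v) j)"
proof -
  have "(\<Sum>w\<in>#mset (offspring_words f i). count_list w j) =
      (\<Sum>w\<in>#mset (map offspring (filter (\<lambda>v. label v = i) (bfs_forest f))). count_list w j)"
    by (simp only: mset_offspring_words)
  then show ?thesis
    unfolding mset_map[symmetric] sum_mset_sum_list by (simp add: count_list_concat comp_def)
qed

lemma count_list_labels_bfs_forest:
  "count_list (map label (bfs_forest f)) j =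
     count_list (root_types f) j + count_list (concat (map offspring (bfs_forest f))) j"
proof -
  have "mset (map label (bfs_forest f)) = mset (root_types f) + mset (concat (map offspring (bfs_forest f)))"
    using arg_cong[OF mset_bfs[of "[]" f], of "image_mset label"]
    by (simp add: root_types_def offspring_def[abs_def] map_concat comp_def bfs_forest_conv_bfs flip: mset_map)
  then show ?thesis by (simp add: count_mset[symmetric])
qed

lemma length_offspring_words:
  assumes "finite I" "label ` set (bfs_forest f) \<subseteq> I"
  shows "length (offspring_words f j) =
    count_list (root_types f) j + (\<Sum>i\<in>I. count_list (concat (offspring_words f i)) j)"
proof -
  have "length (offspring_words f j) = count_list (map label (bfs_forest f)) j"
    using arg_cong[OF mset_offspring_words[of f j], of size]
    by (simp add: count_list_eq_length_filter comp_def eq_commute flip: mset_filter)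
  also have "\<dots> = count_list (root_types f) j + (\<Sum>v\<leftarrow>bfs_forest f. count_list (offspring v) j)"
    by (simp add: count_list_labels_bfs_forest count_list_concat comp_def)
  also have "(\<Sum>v\<leftarrow>bfs_forest f. count_list (offspring v) j) = (\<Sum>i\<in>I. count_list (concat (offspring_words f i)) j)"
    by (simp add: count_list_concat_offspring_words sum_list_filter_partition[OF assms])
  finally show ?thesis .
qed

lemma forest_with_prefix_words_exists:
  assumes "finite I" "set c \<subseteq> I" "\<And>i. i \<notin> I \<Longrightarrow> ws i = []"
    and "\<And>i. set (concat (ws i)) \<subseteq> I"
    and "\<And>j. j \<in> I \<Longrightarrow> count_list c j + (\<Sum>i\<in>I. count_list (concat (ws i)) j) \<le> length (ws j)"
  shows "\<exists>f. root_types f = c \<and> (\<forall>j. prefix (offspring_words f j) (ws j))"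
proof -
  obtain f where f: "root_types f = c" "\<And>j. prefix_padded [] (offspring_words f j) (ws j)"
    using forest_with_padded_words_exists[of I ws c] assms(1,3) by blast
  have concat: "prefix (concat (offspring_words f i)) (concat (ws i))" for i
    using f(2) by (rule prefix_padded_concat)
  have unused: "offspring_words f j = []" if "j \<notin> I" for j
  proof -
    have "count_list (concat (offspring_words f i)) j = 0" for i
      using set_mono_prefix[OF concat[of i]] assms(4)[of i] that by (auto simp: count_list_0_iff)
    moreover have "count_list c j = 0" using assms(2) that by (auto simp: count_list_0_iff)
    ultimately show ?thesis
      using length_offspring_words[of "label ` set (bfs_forest f)" f j] f(1) by simp
  qed
  then have labels: "label ` set (bfs_forest f) \<subseteq> I"
    by (auto simp: offspring_words_eq_Nil_iff)
  have "length (offspring_words f j) \<le> length (ws j)" if "j \<in> I" for j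
  proof -
    have "count_list (concat (offspring_words f i)) j \<le> count_list (concat (ws i)) j" for i
      using concat[of i] by (auto elim: prefixE)
    then have "length (offspring_words f j) \<le> count_list c j + (\<Sum>i\<in>I. count_list (concat (ws i)) j)"
      unfolding length_offspring_words[OF assms(1) labels] f(1) by (intro add_left_mono sum_mono)
    then show ?thesis using assms(5)[OF that] by simp
  qed
  then have "prefix (offspring_words f j) (ws j)" for j
    using f(2)[of j] unused[of j]
    by (cases "j \<in> I") (auto simp: prefix_padded_def intro: prefix_length_prefix)
  then show ?thesis using f(1) by blast
qed

section \<open>Minimal balanced families of words\<close>

definition balanced :: "'a set \<Rightarrow> ('a \<Rightarrow> nat) \<Rightarrow> ('a \<Rightarrow> 'a list list) \<Rightarrow> bool" where
  "balanced I r ws \<longleftrightarrow>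
     (\<forall>j\<in>I. r j + (\<Sum>i\<in>I. count_list (concat (ws i)) j) = length (ws j))"

definition minimal_balanced :: "'a set \<Rightarrow> ('a \<Rightarrow> nat) \<Rightarrow> ('a \<Rightarrow> 'a list list) \<Rightarrow> bool" where
  "minimal_balanced I r ws \<longleftrightarrow> balanced I r ws \<and>
     (\<forall>vs. balanced I r vs \<longrightarrow> (\<forall>i. prefix (vs i) (ws i)) \<longrightarrow> vs = ws)"

definition words_over :: "'a set \<Rightarrow> ('a \<Rightarrow> 'a list list) \<Rightarrow> bool" where
  "words_over I ws \<longleftrightarrow> (\<forall>i. set (concat (ws i)) \<subseteq> I \<and> (i \<notin> I \<longrightarrow> ws i = []))"

lemma words_over_prefix:
  assumes "words_over I ws" "\<And>i. prefix (vs i) (ws i)"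
  shows "words_over I vs"
  unfolding words_over_def
proof (intro allI conjI impI)
  fix i
  have "set (concat (vs i)) \<subseteq> set (concat (ws i))"
    using set_mono_prefix[OF assms(2)[of i]] by auto
  then show "set (concat (vs i)) \<subseteq> I"
    using assms(1) unfolding words_over_def by blast
  show "vs i = []" if "i \<notin> I"
    using assms(1) assms(2)[of i] that by (simp add: words_over_def)
qed

lemma words_over_offspring_words_iff:
  "words_over I (offspring_words f) \<longleftrightarrow> label ` set (bfs_forest f) \<subseteq> I"
proof
  assume "words_over I (offspring_words f)"
  then show "label ` set (bfs_forest f) \<subseteq> I"
    by (force simp: words_over_def offspring_words_eq_Nil_iff)
next
  assume labels: "label ` set (bfs_forest f) \<subseteq> I"
  have "c \<in> set (bfs_forest f)" if "v \<in> set (bfs_forest f)" "c \<in> set (kids v)" for c v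
    using arg_cong[OF mset_bfs[of "[]" f], of set_mset] that by (auto simp: bfs_forest_conv_bfs)
  then have "set (offspring v) \<subseteq> I" if "v \<in> set (bfs_forest f)" for v
    using that labels by (auto simp: offspring_def)
  then show "words_over I (offspring_words f)"
    using labels by (auto simp: words_over_def set_offspring_words offspring_words_eq_Nil_iff)
qed

lemma balanced_offspring_words:
  assumes "finite I" "words_over I (offspring_words f)"
  shows "balanced I (count_list (root_types f)) (offspring_words f)"
  using length_offspring_words assms
  by (simp add: balanced_def words_over_offspring_words_iff)

lemma balanced_forest_exists:
  assumes "finite I" "set c \<subseteq> I" "words_over I ws" "balanced I (count_list c) ws"
  shows "\<exists>f. root_types f = c \<and> (\<forall>j. prefix (offspring_words f j) (ws j))"
  using assms forest_with_prefix_words_exists[of I c ws] by (simp add: words_over_def balanced_def)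

lemma minimal_balanced_offspring_words:
  assumes "finite I" "words_over I (offspring_words f)" "set (root_types f) \<subseteq> I"
  shows "minimal_balanced I (count_list (root_types f)) (offspring_words f)"
  unfolding minimal_balanced_def
proof (intro conjI allI impI)
  show "balanced I (count_list (root_types f)) (offspring_words f)"
    using assms(1,2) by (rule balanced_offspring_words)
  fix vs assume vs: "balanced I (count_list (root_types f)) vs" "\<forall>i. prefix (vs i) (offspring_words f i)"
  then obtain g where g: "root_types g = root_types f" "\<And>j. prefix (offspring_words g j) (vs j)"
    using balanced_forest_exists[OF assms(1,3)] words_over_prefix[OF assms(2)] by blast
  have "prefix (offspring_words g j) (offspring_words f j)" for j
    using g(2) vs(2) prefix_order.trans by blast
  then have "g = f"
    using g(1) by (intro offspring_words_unique) (auto simp: parallel_def)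
  then show "vs = offspring_words f"
    using g(2) vs(2) by (auto intro: prefix_order.antisym)
qed

lemma minimal_balanced_forest_exists:
  assumes "finite I" "set c \<subseteq> I" "words_over I ws" "minimal_balanced I (count_list c) ws"
  shows "\<exists>f. root_types f = c \<and> offspring_words f = ws"
proof -
  obtain f where f: "root_types f = c" "\<And>j. prefix (offspring_words f j) (ws j)"
    using balanced_forest_exists[OF assms(1-3)] assms(4) by (auto simp: minimal_balanced_def)
  have "balanced I (count_list c) (offspring_words f)"
    using balanced_offspring_words[OF assms(1)] words_over_prefix[OF assms(3) f(2)] f(1) by metis
  then have "offspring_words f = ws"
    using assms(4) f(2) by (simp add: minimal_balanced_def)
  then show ?thesis using f(1) by blast
qed

definition sorted_families :: "nat \<Rightarrow> (nat \<Rightarrow> nat list list) set" where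
  "sorted_families d = {ws. words_over {1..d} ws \<and> (\<forall>i. \<forall>w\<in>set (ws i). sorted w)}"

lemma dtype_forest_iff: "dtype_forest d f \<longleftrightarrow> offspring_words f \<in> sorted_families d"
  by (auto simp: dtype_forest_def sorted_families_def words_over_offspring_words_iff set_offspring_words
      offspring_def)

definition minimal_balanced_families :: "nat \<Rightarrow> (nat \<Rightarrow> nat) \<Rightarrow> (nat \<Rightarrow> nat list list) set" where
  "minimal_balanced_families d r =
     {ws \<in> sorted_families d. (\<forall>i\<in>{1..d}. ws i \<noteq> []) \<and> minimal_balanced {1..d} r ws}"

lemma minimal_balanced_cong:
  assumes "\<And>i. i \<in> I \<Longrightarrow> r i = r' i"
  shows "minimal_balanced I r ws \<longleftrightarrow> minimal_balanced I r' ws"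
  using assms by (simp add: minimal_balanced_def balanced_def)

lemma bij_betw_offspring_words:
  "bij_betw (\<lambda>f. (offspring_words f, root_types f)) (Fdr d r) (minimal_balanced_families d r \<times> Cdr d r)"
proof (rule bij_betw_imageI)
  show "inj_on (\<lambda>f. (offspring_words f, root_types f)) (Fdr d r)"
    by (auto intro!: inj_onI offspring_words_unique)
  have Fdr_iff: "f \<in> Fdr d r \<longleftrightarrow> offspring_words f \<in> minimal_balanced_families d r \<and> root_types f \<in> Cdr d r" for f
  proof -
    have "minimal_balanced {1..d} r (offspring_words f)"
      if "offspring_words f \<in> sorted_families d" "root_types f \<in> Cdr d r"
      using minimal_balanced_offspring_words[of "{1..d}" f] that
        minimal_balanced_cong[of "{1..d}" r "count_list (root_types f)"]
      by (auto simp: Cdr_def sorted_families_def)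
    moreover have "length f = length (root_types f)" by (simp add: root_types_def)
    ultimately show ?thesis
      by (auto simp: Fdr_def minimal_balanced_families_def dtype_forest_iff offspring_words_eq_Nil_iff Cdr_def)
  qed
  have "\<exists>f. root_types f = c \<and> offspring_words f = ws"
    if "ws \<in> minimal_balanced_families d r" "c \<in> Cdr d r" for ws c
    using that minimal_balanced_forest_exists[of "{1..d}" c ws]
      minimal_balanced_cong[of "{1..d}" r "count_list c"]
    by (auto simp: minimal_balanced_families_def sorted_families_def Cdr_def)
  then show "(\<lambda>f. (offspring_words f, root_types f)) ` Fdr d r = minimal_balanced_families d r \<times> Cdr d r"
    using Fdr_iff by (auto simp: image_iff) metis
qed

section \<open>Families of words and integer walks\<close>

definition walk :: "nat \<Rightarrow> (nat \<Rightarrow> nat list list) \<Rightarrow> int list list list" where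
  "walk d ws = map (\<lambda>i. map (\<lambda>n. map (\<lambda>j. int (count_list (concat (take n (ws i))) j) - (if i = j then int n else 0))
     [1..<Suc d]) [0..<Suc (length (ws i))]) [1..<Suc d]"

lemma Psi_conv_walk: "Psi d f = walk d (offspring_words f)"
proof -
  have "(\<Sum>m<n. int (nchild j (us ! m)) - (if i = j then 1 else 0)) =
      int (count_list (concat (take n (map offspring us))) j) - (if i = j then int n else 0)"
    if "n \<le> length us" for us i j n
    using that
    by (induction n) (auto simp: take_Suc_conv_app_nth nchild_def count_list_offspring)
  then show ?thesis
    by (simp add: Psi_def walk_def Let_def offspring_words_def del: upt_Suc)
qed

lemma nth_upt_pred: "i \<in> {1..d} \<Longrightarrow> [1..<Suc d] ! (i - 1) = i"
  by (simp add: nth_upt del: upt_Suc)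

lemma walk_nth:
  assumes "i \<in> {1..d}"
  shows "walk d ws ! (i - 1) = map (\<lambda>n. map (\<lambda>j. int (count_list (concat (take n (ws i))) j) -
    (if i = j then int n else 0)) [1..<Suc d]) [0..<Suc (length (ws i))]"
  using assms nth_upt_pred[OF assms] by (auto simp: walk_def simp del: upt_Suc)

lemma xlen_walk: "i \<in> {1..d} \<Longrightarrow> xlen (walk d ws) i = length (ws i)"
  unfolding xlen_def by (subst walk_nth) simp_all

lemma xc_walk:
  assumes "i \<in> {1..d}" "j \<in> {1..d}" "n \<le> length (ws i)"
  shows "xc (walk d ws) i j n =
    int (count_list (concat (take n (ws i))) j) - (if i = j then int n else 0)"
  unfolding xc_def walk_nth[OF assms(1)]
  using assms nth_upt_pred[OF assms(2)] by (auto simp del: upt_Suc)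

lemma xc_walk_Suc:
  assumes "i \<in> {1..d}" "j \<in> {1..d}" "n < length (ws i)"
  shows "xc (walk d ws) i j (Suc n) =
    xc (walk d ws) i j n + int (count_list (ws i ! n) j) - (if i = j then 1 else 0)"
  using assms by (simp add: xc_walk take_Suc_conv_app_nth)

lemma in_Sd_walk: "in_Sd d (walk d ws)"
proof -
  have "walk d ws ! (i - 1) \<noteq> [] \<and> (\<forall>n\<le>xlen (walk d ws) i. length (walk d ws ! (i - 1) ! n) = d)"
    if "i \<in> {1..d}" for i
    unfolding xlen_walk[OF that] walk_nth[OF that] by (auto simp del: upt_Suc)
  moreover have "length (walk d ws) = d" by (simp add: walk_def)
  ultimately show ?thesis by (simp add: in_Sd_def xlen_walk xc_walk_Suc) (simp add: xc_walk)
qed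

lemma in_Sd_eqI:
  assumes "in_Sd d x" "in_Sd d y" "\<And>i. i \<in> {1..d} \<Longrightarrow> xlen x i = xlen y i"
    and "\<And>i j n. i \<in> {1..d} \<Longrightarrow> j \<in> {1..d} \<Longrightarrow> n \<le> xlen x i \<Longrightarrow> xc x i j n = xc y i j n"
  shows "x = y"
proof (rule nth_equalityI)
  show "length x = length y" using assms(1,2) by (simp add: in_Sd_def)
  fix i' assume "i' < length x"
  then obtain i where i: "i \<in> {1..d}" "i' = i - 1"
    using assms(1) by (intro that[of "Suc i'"]) (auto simp: in_Sd_def)
  have length: "length (z ! i') = Suc (xlen z i)" if "in_Sd d z" for z
    using that i by (auto simp: in_Sd_def xlen_def)
  show "x ! i' = y ! i'"
  proof (rule nth_equalityI)
    show "length (x ! i') = length (y ! i')" using length assms(1-3) i(1) by simp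
    fix n assume "n < length (x ! i')"
    then have n: "n \<le> xlen x i" "n \<le> xlen y i" using length assms(1,3) i(1) by auto
    show "x ! i' ! n = y ! i' ! n"
    proof (rule nth_equalityI)
      show "length (x ! i' ! n) = length (y ! i' ! n)"
        using assms(1,2) i n by (simp add: in_Sd_def)
      fix j' assume "j' < length (x ! i' ! n)"
      then have "j' < d" using assms(1) i n by (simp add: in_Sd_def)
      then show "x ! i' ! n ! j' = y ! i' ! n ! j'"
        using assms(4)[of i "Suc j'" n] i n by (simp add: xc_def)
    qed
  qed
qed

lemma in_Sd_eqI_increments:
  assumes "in_Sd d x" "in_Sd d y" "\<And>i. i \<in> {1..d} \<Longrightarrow> xlen x i = xlen y i"
    and increments: "\<And>i j n. i \<in> {1..d} \<Longrightarrow> j \<in> {1..d} \<Longrightarrow> n < xlen x i \<Longrightarrow>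
      xc x i j (Suc n) - xc x i j n = xc y i j (Suc n) - xc y i j n"
  shows "x = y"
proof (rule in_Sd_eqI[OF assms(1-3)])
  fix i j n
  assume ij: "i \<in> {1..d}" "j \<in> {1..d}" and "n \<le> xlen x i"
  from \<open>n \<le> xlen x i\<close> show "xc x i j n = xc y i j n"
  proof (induction n)
    case 0
    then show ?case using assms(1,2) ij by (simp add: in_Sd_def)
  next
    case (Suc n)
    then show ?case using increments[OF ij, of n] by simp
  qed
qed simp_all

lemma sorted_eq_if_count_list_eq:
  fixes xs ys :: "'a::linorder list"
  assumes "sorted xs" "sorted ys" "\<And>a. count_list xs a = count_list ys a"
  shows "xs = ys"
proof -
  have "mset xs = mset ys" using assms(3) by (intro multiset_eqI) (simp add: count_mset)
  then show ?thesis using assms(1,2) properties_for_sort sorted_sort_id by metis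
qed

lemma walk_eqD:
  assumes "walk d ws = walk d vs" "words_over {1..d} ws" "words_over {1..d} vs" "i \<in> {1..d}"
  shows "length (ws i) = length (vs i)"
    and "n < length (ws i) \<Longrightarrow> count_list (ws i ! n) j = count_list (vs i ! n) j"
proof -
  show length: "length (ws i) = length (vs i)"
    using xlen_walk[OF assms(4), of ws] xlen_walk[OF assms(4), of vs] assms(1) by simp
  show "count_list (ws i ! n) j = count_list (vs i ! n) j" if n: "n < length (ws i)"
  proof (cases "j \<in> {1..d}")
    case True
    then show ?thesis
      using xc_walk_Suc[OF assms(4) True, of n ws] xc_walk_Suc[OF assms(4) True, of n vs]
        n length assms(1) by simp
  next
    case False
    then have "j \<notin> set (concat (ws i))" "j \<notin> set (concat (vs i))"
      using assms(2,3) unfolding words_over_def by blast+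
    then show ?thesis using n length by simp
  qed
qed

lemma inj_on_walk: "inj_on (walk d) (sorted_families d)"
proof (rule inj_onI, rule ext)
  fix ws vs i
  assume "ws \<in> sorted_families d" "vs \<in> sorted_families d" and walk: "walk d ws = walk d vs"
  then have over: "words_over {1..d} ws" "words_over {1..d} vs"
    and sorted: "\<And>i w. w \<in> set (ws i) \<Longrightarrow> sorted w" "\<And>i w. w \<in> set (vs i) \<Longrightarrow> sorted w"
    by (auto simp: sorted_families_def)
  show "ws i = vs i"
  proof (cases "i \<in> {1..d}")
    case True
    note eq = walk_eqD[OF walk over True]
    show ?thesis
    proof (rule nth_equalityI[OF eq(1)])
      fix n assume n: "n < length (ws i)"
      show "ws i ! n = vs i ! n"
        using sorted(1)[OF nth_mem[OF n]] sorted(2)[OF nth_mem[OF n[unfolded eq(1)]]] eq(2)[OF n]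
        by (rule sorted_eq_if_count_list_eq)
    qed
  next
    case False
    then show ?thesis using over by (simp add: words_over_def)
  qed
qed

lemma in_Sd_increment_nonneg:
  assumes "in_Sd d x" "i \<in> {1..d}" "j \<in> {1..d}" "n < xlen x i"
  shows "xc x i j (Suc n) - xc x i j n + (if i = j then 1 else 0) \<ge> 0"
proof -
  have "xc x i i (Suc n) - xc x i i n \<ge> -1" "j \<noteq> i \<Longrightarrow> xc x i j n \<le> xc x i j (Suc n)"
    using assms unfolding in_Sd_def by blast+
  then show ?thesis by auto
qed

lemma walk_surj:
  assumes "in_Sd d x"
  shows "\<exists>ws\<in>sorted_families d. walk d ws = x"
proof -
  define k where "k i n j = nat (xc x i j (Suc n) - xc x i j n + (if i = j then 1 else 0))" for i n j
  define word where "word i n = sorted_list_of_multiset (\<Sum>j=1..d. replicate_mset (k i n j) j)" for i n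
  define ws where "ws i = (if i \<in> {1..d} then map (word i) [0..<xlen x i] else [])" for i
  have count_word: "count_list (word i n) j = k i n j" if "j \<in> {1..d}" for i n j
    using that by (simp add: word_def count_sum flip: count_mset)
  have "set (word i n) \<subseteq> {1..d}" for i n
    by (auto simp: word_def set_mset_sum split: if_splits)
  then have "ws \<in> sorted_families d"
    by (auto simp: sorted_families_def words_over_def ws_def word_def)
  moreover have "walk d ws = x"
  proof (rule in_Sd_eqI_increments[OF in_Sd_walk assms])
    fix i assume i: "i \<in> {1..d}"
    show xlen: "xlen (walk d ws) i = xlen x i"
      using i by (simp add: xlen_walk ws_def)
    fix j n assume j: "j \<in> {1..d}" and n: "n < xlen (walk d ws) i"
    then have "xc x i j (Suc n) - xc x i j n + (if i = j then 1 else 0) \<ge> 0"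
      using in_Sd_increment_nonneg assms i xlen by simp
    then have "int (count_list (word i n) j) = xc x i j (Suc n) - xc x i j n + (if i = j then 1 else 0)"
      using j by (simp add: count_word k_def)
    moreover have "ws i ! n = word i n" using i n xlen by (simp add: ws_def)
    ultimately show "xc (walk d ws) i j (Suc n) - xc (walk d ws) i j n = xc x i j (Suc n) - xc x i j n"
      using i j n by (simp add: xc_walk_Suc xlen_walk)
  qed
  ultimately show ?thesis by blast
qed

lemma bij_betw_walk: "bij_betw (walk d) (sorted_families d) {x. in_Sd d x}"
proof (rule bij_betw_imageI[OF inj_on_walk])
  show "walk d ` sorted_families d = {x. in_Sd d x}"
    using walk_surj in_Sd_walk by (force simp: image_iff)
qed

lemma is_solution_walk_iff:
  "is_solution d r (walk d ws) s \<longleftrightarrow>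
     (\<forall>i\<in>{1..d}. s i \<le> length (ws i)) \<and> balanced {1..d} r (\<lambda>i. take (s i) (ws i))"
proof (cases "\<forall>i\<in>{1..d}. s i \<le> length (ws i)")
  case True
  have "int (r j) + (\<Sum>i=1..d. xc (walk d ws) i j (s i)) =
      int (r j + (\<Sum>i=1..d. count_list (concat (take (s i) (ws i))) j)) - int (s j)"
    if j: "j \<in> {1..d}" for j
  proof -
    have "(\<Sum>i=1..d. xc (walk d ws) i j (s i)) =
        (\<Sum>i=1..d. int (count_list (concat (take (s i) (ws i))) j) - (if i = j then int (s j) else 0))"
      using True j by (intro sum.cong) (auto simp: xc_walk)
    then show ?thesis using j by (simp add: sum_subtractf)
  qed
  then show ?thesis
    using True by (auto simp: is_solution_def balanced_def xlen_walk simp del: of_nat_sum of_nat_add)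
next
  case False
  then show ?thesis by (auto simp: is_solution_def xlen_walk)
qed

lemma take_length_prefix: "prefix xs ys \<Longrightarrow> take (length xs) ys = xs"
  by (auto simp: prefix_def)

lemma smallest_solution_walk_iff:
  assumes "words_over {1..d} ws"
  shows "smallest_solution d r (walk d ws) (xlen (walk d ws)) \<longleftrightarrow> minimal_balanced {1..d} r ws"
proof
  assume smallest: "smallest_solution d r (walk d ws) (xlen (walk d ws))"
  have "balanced {1..d} r ws"
    using smallest by (simp add: smallest_solution_def is_solution_walk_iff balanced_def xlen_walk)
  moreover have "vs = ws" if vs: "balanced {1..d} r vs" "\<forall>i. prefix (vs i) (ws i)" for vs
  proof
    fix i
    have "(\<lambda>i. take (length (vs i)) (ws i)) = vs"
      using vs(2) by (simp add: take_length_prefix)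
    then have "is_solution d r (walk d ws) (\<lambda>i. length (vs i))"
      using vs by (simp add: is_solution_walk_iff prefix_length_le)
    then have "xlen (walk d ws) i \<le> length (vs i)" if "i \<in> {1..d}"
      using smallest that unfolding smallest_solution_def by blast
    then have "length (ws i) \<le> length (vs i)"
      using assms by (cases "i \<in> {1..d}") (simp_all add: xlen_walk words_over_def)
    then show "vs i = ws i"
      using take_length_prefix[of "vs i" "ws i"] vs(2) by simp
  qed
  ultimately show "minimal_balanced {1..d} r ws" by (simp add: minimal_balanced_def)
next
  assume minimal: "minimal_balanced {1..d} r ws"
  have "is_solution d r (walk d ws) (xlen (walk d ws))"
    using minimal by (simp add: minimal_balanced_def is_solution_walk_iff balanced_def xlen_walk)
  moreover have "xlen (walk d ws) i \<le> s i" if "is_solution d r (walk d ws) s" "i \<in> {1..d}" for s i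
  proof -
    have "(\<lambda>i. take (s i) (ws i)) = ws"
      using minimal that(1) by (simp add: minimal_balanced_def is_solution_walk_iff take_is_prefix)
    then have "take (s i) (ws i) = ws i" by (rule fun_cong)
    then show ?thesis using that(2) by (simp add: xlen_walk)
  qed
  ultimately show "smallest_solution d r (walk d ws) (xlen (walk d ws))"
    by (simp add: smallest_solution_def)
qed

lemma bij_betw_walk_Sdr: "bij_betw (walk d) (minimal_balanced_families d r) (Sdr d r)"
proof -
  have "bij_betw (walk d)
      {ws \<in> sorted_families d. (\<forall>i\<in>{1..d}. ws i \<noteq> []) \<and> minimal_balanced {1..d} r ws}
      {x \<in> {x. in_Sd d x}. (\<forall>i\<in>{1..d}. xlen x i \<ge> 1) \<and> smallest_solution d r x (xlen x)}"
    by (rule bij_betw_Collect[OF bij_betw_walk])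
      (auto simp: sorted_families_def smallest_solution_walk_iff xlen_walk Suc_le_eq)
  then show ?thesis by (simp add: minimal_balanced_families_def Sdr_def)
qed

theorem theorem2p7:
  fixes d :: nat and r :: "nat \<Rightarrow> nat"
  assumes "d \<ge> 2" and "\<exists>i\<in>{1..d}. r i > 0"
  shows "bij_betw (Phi d) (Fdr d r) (Sdr d r \<times> Cdr d r)"
proof -
  have "bij_betw (map_prod (walk d) id) (minimal_balanced_families d r \<times> Cdr d r) (Sdr d r \<times> Cdr d r)"
    using bij_betw_walk_Sdr by (rule bij_betw_map_prod) simp
  then have "bij_betw (map_prod (walk d) id \<circ> (\<lambda>f. (offspring_words f, root_types f)))
      (Fdr d r) (Sdr d r \<times> Cdr d r)"
    by (rule bij_betw_trans[OF bij_betw_offspring_words])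
  moreover have "map_prod (walk d) id \<circ> (\<lambda>f. (offspring_words f, root_types f)) = Phi d"
    by (simp add: fun_eq_iff Phi_def Psi_conv_walk)
  ultimately show ?thesis by simp
qed

end
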